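(* Let $n\geq 4$ and consider all unicyclic graphs on $n$ vertices. The minimum of the core index over this class is attained by the lollipop graph $U_{n,3}^l$ if $n\geq 7$, and by the cycle $C_n$ if $n\leq 5$. For $n=6$ the minimum is attained by both $C_6$ and $U_{6,3}^l$.
   Context: All graphs are finite, simple and undirected. A unicyclic graph is a connected graph with the same number of vertices and edges. The lollipop graph $U_{n,3}^l$ is obtained from a triangle $C_3$ and a path on $n-2$ vertices by identifying one end vertex of the path with a vertex of the triangle. A connected subgraph of a graph $G=(V,E)$ is a graph $(V',E')$ with $\emptyset\neq V'\subseteq V$, $E'\subseteq E$, every edge of $E'$ having both endpoints in $V'$, and $(V',E')$ connected; distinct pairs $(V',E')$ are counted separately. The core index $F(G)$ is the number of connected subgraphs of $G$. *)

theory Defs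
  imports Main
begin

type_synonym 'a ugraph = "'a set \<times> 'a set set"

definition simple_graph :: "'a ugraph \<Rightarrow> bool" where
  "simple_graph G \<longleftrightarrow> finite (fst G) \<and> (\<forall>e \<in> snd G. e \<subseteq> fst G \<and> card e = 2)"

definition connected_graph :: "'a ugraph \<Rightarrow> bool" where
  "connected_graph G \<longleftrightarrow>
     fst G \<noteq> {} \<and> (\<forall>u \<in> fst G. \<forall>v \<in> fst G. (u, v) \<in> {(x, y). {x, y} \<in> snd G}\<^sup>*)"

definition unicyclic :: "'a ugraph \<Rightarrow> bool" where
  "unicyclic G \<longleftrightarrow> simple_graph G \<and> connected_graph G \<and> card (fst G) = card (snd G)"

definition unicyclic_graphs :: "nat \<Rightarrow> 'a ugraph set" where
  "unicyclic_graphs n = {G. unicyclic G \<and> card (fst G) = n}"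

definition connected_subgraphs :: "'a ugraph \<Rightarrow> 'a ugraph set" where
  "connected_subgraphs G =
     {(V', E'). V' \<noteq> {} \<and> V' \<subseteq> fst G \<and> E' \<subseteq> snd G \<and> (\<forall>e \<in> E'. e \<subseteq> V') \<and> connected_graph (V', E')}"

definition core_index :: "'a ugraph \<Rightarrow> nat" where
  "core_index G = card (connected_subgraphs G)"

definition cycle_graph :: "nat \<Rightarrow> nat ugraph" where
  "cycle_graph n = ({0..<n}, {{i, (i + 1) mod n} | i. i < n})"

text \<open>The triangle is on the vertices 0, 1, 2; the path is 2, 3, ..., n - 1, which has n - 2 vertices
  and shares its end vertex 2 with the triangle.\<close>

definition lollipop_graph :: "nat \<Rightarrow> nat ugraph" where
  "lollipop_graph n =
     ({0..<n}, {{0, 1}, {0, 2}, {1, 2}} \<union> {{i, i + 1} | i. 2 \<le> i \<and> i + 1 < n})"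

end

theory Submission
  imports Defs "HOL-Number_Theory.Cong"
begin

text \<open>Write \<open>F G\<close> for the core index and \<open>F u G\<close> for the number of connected subgraphs
  containing \<open>u\<close>. If \<open>v\<close> is a leaf of \<open>G\<close> with neighbour \<open>u\<close>, then
  \<open>F G = F (G - v) + 1 + F u (G - v)\<close>, and \<open>F w G \<ge> F w' (G - v) + 1\<close> where \<open>w' = u\<close> if \<open>w = v\<close> and
  \<open>w' = w\<close> otherwise. Stripping leaves ends in a cycle, where the connected subgraphs are the whole
  cycle and the arcs: \<open>F C\<^sub>n = n\<^sup>2 + 1\<close> and \<open>F u C\<^sub>n = n (n + 1) / 2 + 1\<close>. Hence
  \<open>F w G \<ge> n + 4\<close> for every unicyclic graph on \<open>n\<close> vertices, and \<open>F G \<ge> (n\<^sup>2 + 9 n - 16) / 2\<close> for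
  every one that is not a cycle. The lollipop attains both bounds, and
  \<open>2 (n\<^sup>2 + 1) - (n\<^sup>2 + 9 n - 16) = (n - 3) (n - 6)\<close> decides between it and the cycle.\<close>

section \<open>Connectedness and pendant vertices\<close>

abbreviation adj :: "'a set set \<Rightarrow> ('a \<times> 'a) set" where
  "adj E \<equiv> {(x, y). {x, y} \<in> E}"

lemma adj_rtrancl_sym: "(x, y) \<in> (adj E)\<^sup>* \<Longrightarrow> (y, x) \<in> (adj E)\<^sup>*"
proof -
  have "sym (adj E)" by (auto simp: sym_def insert_commute)
  then show "(x, y) \<in> (adj E)\<^sup>* \<Longrightarrow> (y, x) \<in> (adj E)\<^sup>*"
    using sym_rtrancl symD by metis
qed

lemma connected_graphI_root:
  assumes "r \<in> V" "\<And>v. v \<in> V \<Longrightarrow> (r, v) \<in> (adj E)\<^sup>*"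
  shows "connected_graph (V, E)"
  unfolding connected_graph_def
  using assms by (auto intro: rtrancl_trans adj_rtrancl_sym)

text \<open>Induction along a walk from \<open>x\<close>: no step leaves \<open>S\<close>. Later
  proofs exploit connectedness in this form, with \<open>S\<close> an explicit set such as a single
  vertex, an arc or a cycle.\<close>

lemma connected_graph_closed_superset:
  assumes "connected_graph (V, E)" "x \<in> V" "x \<in> S"
    and closed: "\<And>a b. a \<in> S \<Longrightarrow> {a, b} \<in> E \<Longrightarrow> b \<in> S"
  shows "V \<subseteq> S"
proof
  fix y assume "y \<in> V"
  then have "(x, y) \<in> (adj E)\<^sup>*"
    using assms(1,2) by (auto simp: connected_graph_def)
  then show "y \<in> S"
    by induction (use assms(3) closed in auto)
qed

lemma connected_graph_insert_pendant:
  assumes "connected_graph (V, E)" "u \<in> V"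
  shows "connected_graph (insert v V, insert {u, v} E)"
proof (rule connected_graphI_root)
  show "u \<in> insert v V" using assms by simp
  fix w assume "w \<in> insert v V"
  moreover have "(u, w) \<in> (adj (insert {u, v} E))\<^sup>*" if "w \<in> V"
  proof -
    have "(u, w) \<in> (adj E)\<^sup>*"
      using assms that by (auto simp: connected_graph_def)
    moreover have "adj E \<subseteq> adj (insert {u, v} E)" by auto
    ultimately show ?thesis using rtrancl_mono by blast
  qed
  ultimately show "(u, w) \<in> (adj (insert {u, v} E))\<^sup>*" by auto
qed

text \<open>Collapsing the pendant vertex onto its neighbour maps walks to walks.\<close>

lemma connected_graph_delete_pendant:
  assumes conn: "connected_graph (V, E)" and "u \<in> V" "u \<noteq> v"
    and pend: "\<And>e. e \<in> E \<Longrightarrow> v \<in> e \<Longrightarrow> e = {u, v}"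
  shows "connected_graph (V - {v}, E - {{u, v}})"
proof (rule connected_graphI_root)
  show "u \<in> V - {v}" using assms by simp
  fix w assume w: "w \<in> V - {v}"
  define f where "f x = (if x = v then u else x)" for x
  have "(u, w) \<in> (adj E)\<^sup>*"
    using conn w \<open>u \<in> V\<close> by (auto simp: connected_graph_def)
  then have "(f u, f w) \<in> (adj (E - {{u, v}}))\<^sup>*"
  proof induction
    case base
    show ?case by simp
  next
    case (step y z)
    have "f y = f z \<or> (f y, f z) \<in> adj (E - {{u, v}})"
    proof (cases "v \<in> {y, z}")
      case True
      then have "{y, z} = {u, v}" using pend step by auto
      then show ?thesis by (auto simp: f_def doubleton_eq_iff)
    next
      case False
      then show ?thesis using step by (auto simp: f_def)
    qed
    then show ?case using step.IH by (auto intro: rtrancl_into_rtrancl)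
  qed
  then show "(u, w) \<in> (adj (E - {{u, v}}))\<^sup>*"
    using w \<open>u \<noteq> v\<close> by (simp add: f_def)
qed

section \<open>Recursion for the core index\<close>

definition rooted_subgraphs :: "'a \<Rightarrow> 'a ugraph \<Rightarrow> 'a ugraph set" where
  "rooted_subgraphs u G = {S \<in> connected_subgraphs G. u \<in> fst S}"

lemma mem_connected_subgraphs:
  "(V', E') \<in> connected_subgraphs (V, E) \<longleftrightarrow>
     V' \<subseteq> V \<and> E' \<subseteq> E \<and> (\<forall>e\<in>E'. e \<subseteq> V') \<and> connected_graph (V', E')"
  by (auto simp: connected_subgraphs_def connected_graph_def)

lemma finite_connected_subgraphs:
  assumes "simple_graph G"
  shows "finite (connected_subgraphs G)"
proof (rule finite_subset)
  show "connected_subgraphs G \<subseteq> Pow (fst G) \<times> Pow (snd G)"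
    by (auto simp: connected_subgraphs_def)
  have "snd G \<subseteq> Pow (fst G)" "finite (fst G)"
    using assms by (auto simp: simple_graph_def)
  then show "finite (Pow (fst G) \<times> Pow (snd G))"
    by (meson finite_Pow_iff finite_SigmaI finite_subset)
qed

lemma finite_rooted_subgraphs:
  "simple_graph G \<Longrightarrow> finite (rooted_subgraphs u G)"
  by (simp add: rooted_subgraphs_def finite_connected_subgraphs)

lemma simple_graph_insert_pendant:
  assumes "simple_graph (V, E)" "u \<in> V" "v \<notin> V"
  shows "simple_graph (insert v V, insert {u, v} E)"
  using assms by (auto simp: simple_graph_def card_insert_if)

text \<open>A subgraph avoiding \<open>v\<close> lives in the old graph. One that contains
  \<open>v\<close> but not the edge \<open>{u, v}\<close> has \<open>v\<close> isolated, so
  connectedness leaves only \<open>v\<close>. One with the edge also contains \<open>u\<close>, and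
  removing the pendant vertex yields a connected subgraph rooted at \<open>u\<close>.\<close>

lemma connected_subgraphs_insert_pendant:
  assumes sg: "simple_graph (V, E)" and u: "u \<in> V" and v: "v \<notin> V"
  shows "connected_subgraphs (insert v V, insert {u, v} E) =
    connected_subgraphs (V, E) \<union> {({v}, {})} \<union>
    (\<lambda>(V', E'). (insert v V', insert {u, v} E')) ` rooted_subgraphs u (V, E)"
    (is "?L = ?A \<union> ?B \<union> ?f ` ?R")
proof
  have vE: "v \<notin> e" if "e \<in> E" for e
    using sg v that by (auto simp: simple_graph_def)
  have uv: "u \<noteq> v" using u v by auto
  show "?L \<subseteq> ?A \<union> ?B \<union> ?f ` ?R"
  proof
    fix S assume "S \<in> ?L"
    then obtain V' E' where S: "S = (V', E')" and
      sub: "V' \<subseteq> insert v V" "E' \<subseteq> insert {u, v} E" "\<forall>e\<in>E'. e \<subseteq> V'" "connected_graph (V', E')"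
      by (cases S) (auto simp: mem_connected_subgraphs)
    show "S \<in> ?A \<union> ?B \<union> ?f ` ?R"
    proof (cases "v \<in> V'")
      case False
      then have "{u, v} \<notin> E'" using sub by auto
      then have "S \<in> ?A" using S sub False by (auto simp: mem_connected_subgraphs)
      then show ?thesis by simp
    next
      case vV': True
      show ?thesis
      proof (cases "{u, v} \<in> E'")
        case False
        then have E'E: "E' \<subseteq> E" using sub by auto
        \<comment> \<open>Without \<open>{u, v}\<close> no edge of \<open>E'\<close> meets
          \<open>v\<close>, so \<open>{v}\<close> is closed under adjacency.\<close>
        have "V' \<subseteq> {v}"
          by (rule connected_graph_closed_superset[OF sub(4) vV']) (use E'E vE in auto)
        then have V': "V' = {v}" using vV' by auto
        have "E' = {}"
        proof (rule ccontr)
          assume "E' \<noteq> {}"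
          then obtain e where "e \<in> E'" by auto
          then have "e \<subseteq> {v}" "e \<in> E" using sub V' E'E by auto
          then show False using vE[of e] sg by (auto simp: simple_graph_def subset_singleton_iff)
        qed
        then show ?thesis using V' S by simp
      next
        case True
        then have uV': "u \<in> V'" using sub by auto
        have "connected_graph (V' - {v}, E' - {{u, v}})"
          by (rule connected_graph_delete_pendant) (use sub uV' uv vE in auto)
        then have "(V' - {v}, E' - {{u, v}}) \<in> ?R"
          using sub uV' uv vE
          by (auto simp: rooted_subgraphs_def mem_connected_subgraphs)
        moreover have "S = ?f (V' - {v}, E' - {{u, v}})"
          using S True vV' by auto
        ultimately show ?thesis by blast
      qed
    qed
  qed
  have "connected_graph ({v}, {})" by (auto simp: connected_graph_def)
  then have "?A \<subseteq> ?L" "?B \<subseteq> ?L"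
    by (auto simp: mem_connected_subgraphs)
  moreover have "?f S \<in> ?L" if "S \<in> ?R" for S
  proof -
    obtain V' E' where S: "S = (V', E')" by (cases S)
    have sub: "V' \<subseteq> V" "E' \<subseteq> E" "\<forall>e\<in>E'. e \<subseteq> V'" "connected_graph (V', E')" "u \<in> V'"
      using that unfolding S rooted_subgraphs_def by (auto simp: mem_connected_subgraphs)
    then have "connected_graph (insert v V', insert {u, v} E')"
      by (blast intro: connected_graph_insert_pendant)
    then show ?thesis
      unfolding S prod.case mem_connected_subgraphs using sub by blast
  qed
  ultimately show "?A \<union> ?B \<union> ?f ` ?R \<subseteq> ?L" by blast
qed

text \<open>Members of the old graph never mention \<open>v\<close>. Hence the three families of the
  decomposition are disjoint, attaching \<open>v\<close> is injective, and the subgraphs rooted at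
  \<open>v\<close> are exactly the last two families.\<close>

lemma
  assumes sg: "simple_graph (V, E)" and u: "u \<in> V" and v: "v \<notin> V"
  shows core_index_insert_pendant:
      "core_index (insert v V, insert {u, v} E) =
         core_index (V, E) + 1 + card (rooted_subgraphs u (V, E))" (is ?core)
    and card_rooted_subgraphs_pendant:
      "card (rooted_subgraphs v (insert v V, insert {u, v} E)) =
         1 + card (rooted_subgraphs u (V, E))" (is ?end)
proof -
  let ?G = "(V, E)" and ?H = "(insert v V, insert {u, v} E)"
  let ?f = "\<lambda>(V', E'). (insert v V', insert {u, v} E')"
  let ?R = "rooted_subgraphs u ?G"
  note eq = connected_subgraphs_insert_pendant[OF assms]
  have vE: "v \<notin> e" if "e \<in> E" for e
    using sg v that by (auto simp: simple_graph_def)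
  have vR: "V' \<subseteq> V \<and> E' \<subseteq> E" if "(V', E') \<in> connected_subgraphs ?G" for V' E'
    using that by (simp add: mem_connected_subgraphs)
  have inj: "inj_on ?f ?R"
  proof (rule inj_onI, clarsimp simp: rooted_subgraphs_def)
    fix V1 E1 V2 E2
    assume *: "(V1, E1) \<in> connected_subgraphs ?G" "(V2, E2) \<in> connected_subgraphs ?G"
      and eqs: "insert v V1 = insert v V2" "insert {u, v} E1 = insert {u, v} E2"
    have "v \<notin> V1" "v \<notin> V2" "{u, v} \<notin> E1" "{u, v} \<notin> E2"
      using vR[OF *(1)] vR[OF *(2)] v vE[of "{u, v}"] by auto
    then show "V1 = V2 \<and> E1 = E2" using eqs by (simp add: insert_ident)
  qed
  have fin: "finite (connected_subgraphs ?G)" "finite ?R"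
    using sg by (simp_all add: finite_connected_subgraphs finite_rooted_subgraphs)
  have v_notin: "v \<notin> fst S" if "S \<in> connected_subgraphs ?G" for S
    using vR that v by (cases S) auto
  have not_in: "({v}, {}) \<notin> ?f ` ?R" by auto
  have disj: "connected_subgraphs ?G \<inter> insert ({v}, {}) (?f ` ?R) = {}"
    using v_notin by fastforce
  have card1: "card (insert ({v}, {}) (?f ` ?R)) = 1 + card ?R"
    using not_in fin by (simp add: card_image[OF inj])
  have "core_index ?H = card (connected_subgraphs ?G \<union> insert ({v}, {}) (?f ` ?R))"
    unfolding core_index_def eq by (rule arg_cong[where f = card]) auto
  also have "\<dots> = core_index ?G + (1 + card ?R)"
    using disj fin by (subst card_Un_disjoint) (auto simp: core_index_def card1)
  finally show ?core by simp
  have "rooted_subgraphs v ?H = insert ({v}, {}) (?f ` ?R)"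
    unfolding rooted_subgraphs_def[of v] eq using v_notin by auto
  then show ?end using card1 by simp
qed

text \<open>All old subgraphs rooted at \<open>w\<close> survive, and the entire new graph is one
  more. This crude gain of one is enough for the linear lower bound on rooted counts.\<close>

lemma card_rooted_subgraphs_insert_pendant:
  assumes sg: "simple_graph (V, E)" and conn: "connected_graph (V, E)"
    and u: "u \<in> V" and v: "v \<notin> V" and w: "w \<in> V"
  shows "card (rooted_subgraphs w (V, E)) + 1 \<le>
    card (rooted_subgraphs w (insert v V, insert {u, v} E))"
proof -
  let ?G = "(V, E)" and ?H = "(insert v V, insert {u, v} E)"
  have sgH: "simple_graph ?H"
    using sg u v by (rule simple_graph_insert_pendant)
  have "?H \<in> rooted_subgraphs w ?H"
    using connected_graph_insert_pendant[OF conn u] sgH w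
    by (auto simp: rooted_subgraphs_def mem_connected_subgraphs simple_graph_def)
  moreover have "rooted_subgraphs w ?G \<subseteq> rooted_subgraphs w ?H"
    by (auto simp: rooted_subgraphs_def mem_connected_subgraphs)
  moreover have "?H \<notin> rooted_subgraphs w ?G"
    using v by (auto simp: rooted_subgraphs_def mem_connected_subgraphs)
  ultimately have "rooted_subgraphs w ?G \<subset> rooted_subgraphs w ?H" by blast
  then show ?thesis
    using psubset_card_mono[OF finite_rooted_subgraphs[OF sgH]] by (simp add: Suc_le_eq)
qed

section \<open>Cycles\<close>

text \<open>A cyclic enumeration of the vertices by all natural numbers, periodic with period \<open>n\<close>,
  keeps modular arithmetic out of the description of arcs.\<close>

locale cyclic_enum =
  fixes n :: nat and p :: "nat \<Rightarrow> 'a"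
  assumes n3: "n \<ge> 3"
    and p_eq_iff: "p i = p j \<longleftrightarrow> i mod n = j mod n"
begin

definition edge :: "nat \<Rightarrow> 'a set" where
  "edge i = {p i, p (Suc i)}"

definition whole :: "'a ugraph" where
  "whole = (range p, range edge)"

text \<open>\<open>m\<close> counts edges, so an arc with \<open>m < n\<close> has
  \<open>m + 1\<close> vertices; \<open>m = n - 1\<close> gives the cycle with a single edge
  removed.\<close>

definition arc :: "nat \<Rightarrow> nat \<Rightarrow> 'a ugraph" where
  "arc i m = (p ` {i..i + m}, edge ` {i..<i + m})"

section \<open>Coincidences of vertices and edges modulo the period\<close>

lemma p_add_period: "p (i + n) = p i"
  by (simp add: p_eq_iff)

lemma p_add_cancel: "p (i + k) = p (j + k) \<longleftrightarrow> p i = p j"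
  using cong_add_rcancel_nat[of i k j n] by (simp add: p_eq_iff cong_def)

lemma p_Suc_cancel: "p (Suc i) = p (Suc j) \<longleftrightarrow> p i = p j"
  using p_add_cancel[of i 1 j] by simp

lemma p_eq_add_iff: "p i = p (i + k) \<longleftrightarrow> n dvd k"
proof -
  have "p i = p (i + k) \<longleftrightarrow> p 0 = p k"
    using p_add_cancel[of 0 i k] by (simp add: add.commute)
  then show ?thesis by (auto simp: p_eq_iff dvd_eq_mod_eq_0)
qed

lemma p_add_inj: "t < n \<Longrightarrow> s < n \<Longrightarrow> p (i + t) = p (i + s) \<longleftrightarrow> t = s"
  using p_add_cancel[of t i s] by (simp add: p_eq_iff add.commute[of i])

text \<open>Two edges traversed in opposite directions could only coincide if the period divided 2,
  which \<open>n3\<close> excludes.\<close>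

lemma edge_eq_iff: "edge i = edge j \<longleftrightarrow> p i = p j"
proof
  assume "edge i = edge j"
  then consider "p i = p j" | "p i = p (Suc j)" "p (Suc i) = p j"
    by (auto simp: edge_def doubleton_eq_iff)
  then show "p i = p j"
  proof cases
    case 2
    then have "p j = p (j + 2)"
      using p_Suc_cancel[of i "Suc j"] by simp
    then have "n dvd 2" by (simp only: p_eq_add_iff)
    then show ?thesis using n3 by (auto dest: dvd_imp_le)
  qed
next
  assume "p i = p j"
  moreover from this have "p (Suc i) = p (Suc j)" by (simp only: p_Suc_cancel)
  ultimately show "edge i = edge j" by (simp add: edge_def)
qed

lemma range_p: "range p = p ` {..<n}"
proof -
  have "p i \<in> p ` {..<n}" for i
    using n3 by (intro image_eqI[of _ _ "i mod n"]) (auto simp: p_eq_iff)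
  then show ?thesis by auto
qed

lemma range_edge: "range edge = edge ` {..<n}"
proof -
  have "edge i \<in> edge ` {..<n}" for i
    using n3 by (intro image_eqI[of _ _ "i mod n"]) (auto simp: p_eq_iff edge_eq_iff)
  then show ?thesis by auto
qed

lemma card_range_p: "card (range p) = n"
  unfolding range_p by (subst card_image) (auto simp: inj_on_def p_eq_iff)

lemma card_range_edge: "card (range edge) = n"
  unfolding range_edge by (subst card_image) (auto simp: inj_on_def edge_eq_iff p_eq_iff)

section \<open>Arcs and the whole cycle as connected subgraphs\<close>

lemma arc_path: "t \<le> m \<Longrightarrow> (p i, p (i + t)) \<in> (adj (edge ` {i..<i + m}))\<^sup>*"
proof (induction t)
  case (Suc t)
  then have "{p (i + t), p (i + Suc t)} \<in> edge ` {i..<i + m}"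
    by (auto simp: edge_def)
  then show ?case
    using Suc by (auto intro: rtrancl_into_rtrancl)
qed simp

lemma connected_arc: "connected_graph (arc i m)"
  unfolding arc_def
proof (rule connected_graphI_root)
  show "p i \<in> p ` {i..i + m}" by simp
  fix v assume "v \<in> p ` {i..i + m}"
  then obtain t where "v = p (i + t)" "t \<le> m"
    by (auto simp: image_iff) (metis add_le_cancel_left le_Suc_ex)
  then show "(p i, v) \<in> (adj (edge ` {i..<i + m}))\<^sup>*"
    using arc_path by simp
qed

lemma connected_whole: "connected_graph whole"
  unfolding whole_def
proof (rule connected_graphI_root)
  show "p 0 \<in> range p" by simp
  fix v assume "v \<in> range p"
  then obtain t where t: "v = p t" by auto
  have "adj (edge ` {0..<t}) \<subseteq> adj (range edge)" by auto
  then have "(adj (edge ` {0..<t}))\<^sup>* \<subseteq> (adj (range edge))\<^sup>*" by (rule rtrancl_mono)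
  moreover have "(p 0, p t) \<in> (adj (edge ` {0..<t}))\<^sup>*"
    using arc_path[of t t 0] by simp
  ultimately show "(p 0, v) \<in> (adj (range edge))\<^sup>*"
    unfolding t by blast
qed

lemma unicyclic_whole: "unicyclic whole"
proof -
  have "p i \<noteq> p (Suc i)" for i
    using p_eq_add_iff[of i 1] n3 by simp
  then have "simple_graph whole"
    by (auto simp: simple_graph_def whole_def range_p[symmetric] edge_def) (simp add: range_p)
  then show ?thesis
    using connected_whole by (simp add: unicyclic_def whole_def card_range_p card_range_edge)
qed

lemma arc_subgraph: "arc i m \<in> connected_subgraphs whole"
proof -
  have "edge t \<subseteq> p ` {i..i + m}" if "t \<in> {i..<i + m}" for t
    using that by (auto simp: edge_def)
  then have "\<forall>e\<in>edge ` {i..<i + m}. e \<subseteq> p ` {i..i + m}" by blast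
  then show ?thesis
    using connected_arc[of i m] unfolding arc_def whole_def mem_connected_subgraphs by blast
qed

lemma whole_subgraph: "whole \<in> connected_subgraphs whole"
proof -
  have "edge t \<subseteq> range p" for t
    by (simp add: edge_def)
  then show ?thesis
    using connected_whole unfolding whole_def mem_connected_subgraphs by blast
qed

text \<open>Edge indices of the arc exceed \<open>i\<close> by at least 1 and at most
  \<open>m\<close>, so no difference is a multiple of \<open>n\<close>. Starting arcs at
  \<open>Suc i\<close> lets the preceding edge have index \<open>i\<close> without
  subtraction.\<close>

lemma edge_before_arc: "m < n \<Longrightarrow> edge i \<notin> snd (arc (Suc i) m)"
proof
  assume m: "m < n" and "edge i \<in> snd (arc (Suc i) m)"
  then obtain t where "edge i = edge t" "Suc i \<le> t" "t < Suc i + m"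
    by (auto simp: arc_def)
  then have "p i = p (i + (t - i))" by (simp add: edge_eq_iff)
  then have "n dvd t - i" by (simp only: p_eq_add_iff)
  then show False
    using m \<open>Suc i \<le> t\<close> \<open>t < Suc i + m\<close> by (auto dest: dvd_imp_le)
qed

lemma arc_neq_whole: "m < n \<Longrightarrow> arc (Suc i) m \<noteq> whole"
  using edge_before_arc[of m i] by (auto simp: whole_def)

text \<open>The starting point of an arc is its only vertex whose preceding edge is missing.\<close>

lemma arc_start:
  assumes "m < n" "p (Suc j) \<in> fst (arc (Suc i) m)" "edge j \<notin> snd (arc (Suc i) m)"
  shows "p i = p j"
proof -
  obtain t where t: "p (Suc j) = p t" "Suc i \<le> t" "t \<le> Suc i + m"
    using assms(2) by (auto simp: arc_def)
  then obtain s where s: "t = Suc s" by (cases t) auto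
  then have ps: "p j = p s" using t by (simp add: p_Suc_cancel)
  show ?thesis
  proof (cases "s = i")
    case False
    then have "edge s \<in> snd (arc (Suc i) m)" using t s by (auto simp: arc_def)
    then show ?thesis using assms(3) ps edge_eq_iff[of j s] by simp
  qed (use ps in simp)
qed

lemma card_arc: "m < n \<Longrightarrow> card (fst (arc i m)) = Suc m"
proof -
  assume m: "m < n"
  have "inj_on p {i..i + m}"
  proof (rule inj_onI)
    fix x y assume *: "x \<in> {i..i + m}" "y \<in> {i..i + m}" "p x = p y"
    then have "x - i < n" "y - i < n" "p (i + (x - i)) = p (i + (y - i))"
      using m by auto
    then have "x - i = y - i" by (simp only: p_add_inj)
    then show "x = y" using * by auto
  qed
  then show ?thesis by (simp add: arc_def card_image)
qed

text \<open>The number of vertices recovers \<open>m\<close>, and the vertex whose preceding edge is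
  missing recovers the start.\<close>

lemma inj_on_arc: "inj_on (\<lambda>(i, m). arc (Suc i) m) ({..<n} \<times> {..<n})"
proof (rule inj_onI, clarsimp)
  fix i m j k
  assume *: "i < n" "m < n" "j < n" "k < n" "arc (Suc i) m = arc (Suc j) k"
  have "m = k" using card_arc[of m "Suc i"] card_arc[of k "Suc j"] * by simp
  have "p (Suc j) \<in> fst (arc (Suc j) k)" by (simp add: arc_def)
  moreover have "edge j \<notin> snd (arc (Suc j) k)" using * edge_before_arc by simp
  ultimately have "p i = p j" using * arc_start[of m j i] by simp
  then show "i = j \<and> m = k" using * \<open>m = k\<close> by (simp add: p_eq_iff)
qed

text \<open>If every vertex of the subgraph comes with its preceding edge, walking backwards
  exhausts the cycle. Otherwise start at a vertex whose preceding edge is missing and follow edges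
  forwards up to the first gap; connectedness confines the subgraph to this arc.\<close>

lemma connected_subgraph_cases:
  assumes "S \<in> connected_subgraphs whole"
  shows "S = whole \<or> (\<exists>i<n. \<exists>m<n. S = arc (Suc i) m)"
proof -
  obtain V' E' where S: "S = (V', E')" by (cases S)
  have sub: "V' \<subseteq> range p" "E' \<subseteq> range edge" "\<forall>e\<in>E'. e \<subseteq> V'" "connected_graph (V', E')"
    using assms unfolding S whole_def mem_connected_subgraphs by auto
  obtain x where x: "p x \<in> V'"
    using sub(1,4) by (fastforce simp: connected_graph_def)
  show ?thesis
  proof (cases "\<exists>i. p (Suc i) \<in> V' \<and> edge i \<notin> E'")
    case False
    then have pred: "p i \<in> V'" if "p (Suc i) \<in> V'" for i
    proof -
      have "edge i \<in> E'" using False that by blast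
      then show ?thesis using sub(3) by (auto simp: edge_def)
    qed
    have down: "p i \<in> V'" if "i \<le> j" "p j \<in> V'" for i j
      using that by (induction rule: inc_induct) (auto intro: pred)
    have V': "p i \<in> V'" for i
    proof (rule down)
      \<comment> \<open>Another index for the vertex \<open>p x\<close>, large enough for the
        descent to reach \<open>i\<close>.\<close>
      show "p (x + n * i) \<in> V'" using x p_eq_iff[of "x + n * i" x] by simp
      show "i \<le> x + n * i" using n3 by (simp add: trans_le_add2)
    qed
    then have "S = whole" using S sub False by (auto simp: whole_def)
    then show ?thesis by simp
  next
    case True
    then obtain i0 where "p (Suc i0) \<in> V'" "edge i0 \<notin> E'" by auto
    then obtain i where i: "i < n" "p (Suc i) \<in> V'" "edge i \<notin> E'"
      using that[of "i0 mod n"] n3 p_eq_iff[of "i0 mod n" i0]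
        p_Suc_cancel[of "i0 mod n" i0] edge_eq_iff[of "i0 mod n" i0] by auto
    define m where "m = (LEAST m. edge (Suc i + m) \<notin> E')"
    \<comment> \<open>After \<open>n - 1\<close> steps the missing edge before the start is met
      again, so the first gap occurs with \<open>m < n\<close>.\<close>
    have "edge (Suc i + (n - 1)) = edge i"
      using n3 p_add_period[of i] by (simp add: edge_eq_iff)
    then have last: "edge (Suc i + (n - 1)) \<notin> E'" using i by simp
    have m1: "edge (Suc i + m) \<notin> E'"
      unfolding m_def using last by (rule LeastI)
    have "m \<le> n - 1"
      unfolding m_def using last by (rule Least_le)
    then have m: "m < n" using n3 by simp
    have m2: "edge (Suc i + t) \<in> E'" if "t < m" for t
      using not_less_Least that unfolding m_def by blast
    \<comment> \<open>The arc can be left only backwards through \<open>edge i\<close> or forwards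
      through \<open>edge (Suc i + m)\<close>, and neither belongs to \<open>E'\<close>.\<close>
    have "V' \<subseteq> p ` {Suc i..Suc i + m}"
    proof (rule connected_graph_closed_superset[OF sub(4) i(2)])
      show "p (Suc i) \<in> p ` {Suc i..Suc i + m}" by simp
      fix a b assume a: "a \<in> p ` {Suc i..Suc i + m}" and ab: "{a, b} \<in> E'"
      obtain t where t: "a = p (Suc t)" "i \<le> t" "t \<le> i + m"
        using a by (auto simp: image_iff) (metis Suc_le_D Suc_le_mono)
      obtain j where j: "{a, b} = edge j" using ab sub by auto
      then consider "a = p j" "b = p (Suc j)" | "a = p (Suc j)" "b = p j"
        by (auto simp: edge_def doubleton_eq_iff)
      then show "b \<in> p ` {Suc i..Suc i + m}"
      proof cases
        case 1
        then have "edge (Suc t) \<in> E'" using ab j t by (metis edge_eq_iff)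
        then have "t \<noteq> i + m" using m1 by auto
        moreover have "b = p (Suc (Suc t))" using 1 t p_Suc_cancel by simp
        ultimately show ?thesis using t by auto
      next
        case 2
        then have "b = p t" using t p_Suc_cancel by simp
        then have "edge t \<in> E'" using ab j 2 by (metis edge_eq_iff)
        then have "t \<noteq> i" using i by auto
        then show ?thesis using t \<open>b = p t\<close> by auto
      qed
    qed
    moreover have "p (Suc i + t) \<in> V'" if "t \<le> m" for t
    proof (cases t)
      case (Suc s)
      then have "edge (Suc i + s) \<in> E'" using m2 that by simp
      then show ?thesis using sub(3) Suc by (auto simp: edge_def)
    qed (use i in simp)
    ultimately have V': "V' = p ` {Suc i..Suc i + m}"
      by (auto simp: image_iff) (metis add_Suc le_Suc_ex nat_add_left_cancel_le)
    have "E' \<subseteq> edge ` {Suc i..<Suc i + m}"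
    proof
      fix e assume e: "e \<in> E'"
      then obtain j where j: "e = edge j" using sub by auto
      then have "p j \<in> V'" using e sub by (auto simp: edge_def)
      then obtain t where t: "p j = p t" "t \<in> {Suc i..Suc i + m}" using V' by auto
      then have "e = edge t" using j edge_eq_iff by simp
      moreover have "t \<noteq> Suc i + m" using e calculation m1 by auto
      ultimately show "e \<in> edge ` {Suc i..<Suc i + m}" using t by auto
    qed
    moreover have "edge ` {Suc i..<Suc i + m} \<subseteq> E'"
      using m2 by (auto simp: image_iff) (metis add_Suc le_Suc_ex nat_add_left_cancel_less)
    ultimately have "S = arc (Suc i) m" using S V' by (simp add: arc_def)
    then show ?thesis using i m by blast
  qed
qed

section \<open>Counting the connected subgraphs of a cycle\<close>

lemma connected_subgraphs_whole:
  "connected_subgraphs whole =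
     insert whole ((\<lambda>(i, m). arc (Suc i) m) ` ({..<n} \<times> {..<n}))"
proof (intro equalityI subsetI)
  fix S assume "S \<in> connected_subgraphs whole"
  from connected_subgraph_cases[OF this]
  show "S \<in> insert whole ((\<lambda>(i, m). arc (Suc i) m) ` ({..<n} \<times> {..<n}))"
    by auto
qed (use arc_subgraph whole_subgraph in auto)

lemma core_index_whole: "core_index whole = n\<^sup>2 + 1"
proof -
  have "whole \<notin> (\<lambda>(i, m). arc (Suc i) m) ` ({..<n} \<times> {..<n})"
    using arc_neq_whole by (auto simp: eq_commute[of whole])
  then show ?thesis
    unfolding core_index_def connected_subgraphs_whole
    by (simp add: card_image[OF inj_on_arc] power2_eq_square)
qed

text \<open>The indices of the arc start between 1 and \<open>n\<close>, so the first multiple of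
  \<open>n\<close> they can meet is \<open>n\<close> itself.\<close>

lemma p0_in_arc_iff:
  assumes "i < n" "m < n"
  shows "p 0 \<in> fst (arc (Suc i) m) \<longleftrightarrow> n \<le> Suc i + m"
proof
  assume "p 0 \<in> fst (arc (Suc i) m)"
  then obtain t where t: "p 0 = p (0 + t)" "Suc i \<le> t" "t \<le> Suc i + m"
    by (auto simp: arc_def)
  then have "n dvd t" by (simp only: p_eq_add_iff)
  then show "n \<le> Suc i + m" using t by (auto dest: dvd_imp_le)
next
  assume "n \<le> Suc i + m"
  then show "p 0 \<in> fst (arc (Suc i) m)"
    using assms p_add_period[of 0] by (auto simp: arc_def image_iff intro!: bexI[of _ n])
qed

text \<open>An arc starting at \<open>Suc i\<close> reaches \<open>p 0\<close> for
  \<open>Suc i\<close> of its \<open>n\<close> possible lengths. These sum to a triangular number,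
  doubled to avoid division, and the whole cycle adds one.\<close>

lemma card_rooted_subgraphs_p0:
  "2 * card (rooted_subgraphs (p 0) whole) = n * (n + 1) + 2"
proof -
  let ?f = "\<lambda>(i, m). arc (Suc i) m" and ?I = "SIGMA i:{..<n}. {n - Suc i..<n}"
  have sub: "?I \<subseteq> {..<n} \<times> {..<n}" by auto
  have "rooted_subgraphs (p 0) whole = insert whole (?f ` ?I)"
    unfolding rooted_subgraphs_def connected_subgraphs_whole
    using p0_in_arc_iff by (fastforce simp: whole_def image_iff)
  moreover have "whole \<notin> ?f ` ?I"
    using arc_neq_whole by (auto simp: eq_commute[of whole])
  ultimately have "card (rooted_subgraphs (p 0) whole) = card ?I + 1"
    by (simp add: card_image[OF inj_on_subset[OF inj_on_arc sub]])
  moreover have "card ?I = (\<Sum>i<n. Suc i)"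
    by simp
  moreover have "2 * (\<Sum>i<k. Suc i) = k * (k + 1)" for k
    by (induction k) auto
  ultimately show ?thesis by simp
qed

lemma rotate: "cyclic_enum n (\<lambda>i. p (i + j))"
  using n3 p_add_cancel by unfold_locales (auto simp: p_eq_iff)

lemma range_rotate:
  fixes f :: "nat \<Rightarrow> 'b"
  assumes "\<And>i. f (i + n) = f i"
  shows "range (\<lambda>i. f (i + j)) = range f"
proof -
  have per: "f (i + k * n) = f i" for i k
  proof (induction k)
    case (Suc k)
    then show ?case using assms[of "i + k * n"] by (simp add: algebra_simps)
  qed simp
  have "f i \<in> range (\<lambda>i. f (i + j))" for i
  proof (rule image_eqI)
    \<comment> \<open>Together with the shift by \<open>j\<close>, the offset
      \<open>j * n - j\<close> makes a whole number of periods.\<close>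
    have "j \<le> j * n" using n3 by simp
    then have "(i + (j * n - j)) + j = i + j * n" by linarith
    then show "f i = f ((i + (j * n - j)) + j)" by (simp only: per)
  qed simp
  then show ?thesis by auto
qed

end

text \<open>Rotating the enumeration moves \<open>u\<close> to index 0 and leaves
  \<open>whole\<close> unchanged, so the count at \<open>p 0\<close> applies.\<close>

lemma (in cyclic_enum) card_rooted_subgraphs_whole:
  assumes "u \<in> fst whole"
  shows "2 * card (rooted_subgraphs u whole) = n * (n + 1) + 2"
proof -
  obtain j where j: "u = p j" using assms by (auto simp: whole_def)
  interpret r: cyclic_enum n "\<lambda>i. p (i + j)" by (rule rotate)
  have "r.edge = (\<lambda>i. edge (i + j))"
    by (simp add: fun_eq_iff r.edge_def edge_def)
  then have "r.whole = whole"
    using range_rotate[of p j] range_rotate[of edge j]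
    by (simp add: r.whole_def whole_def p_add_period edge_eq_iff)
  then show ?thesis using r.card_rooted_subgraphs_p0 j by simp
qed

section \<open>Recognising cycles\<close>

text \<open>Cycles over an arbitrary vertex type, whatever their vertices are called;
  \<open>cyclic_enum\<close> forces length at least 3.\<close>

definition is_cycle :: "'a ugraph \<Rightarrow> bool" where
  "is_cycle G \<longleftrightarrow> (\<exists>n p. cyclic_enum n p \<and> G = cyclic_enum.whole p)"

lemma
  assumes "is_cycle G"
  shows core_index_cycle: "core_index G = (card (fst G))\<^sup>2 + 1"
    and card_rooted_subgraphs_cycle:
      "u \<in> fst G \<Longrightarrow> 2 * card (rooted_subgraphs u G) = card (fst G) * (card (fst G) + 1) + 2"
    and unicyclic_cycle: "unicyclic G"
proof -
  obtain n p where "cyclic_enum n p" and G: "G = cyclic_enum.whole p"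
    using assms by (auto simp: is_cycle_def)
  then interpret cyclic_enum n p by simp
  have n: "card (fst G) = n" by (simp add: G whole_def card_range_p)
  show "core_index G = (card (fst G))\<^sup>2 + 1"
    unfolding n unfolding G by (rule core_index_whole)
  show "unicyclic G" unfolding G by (rule unicyclic_whole)
  assume "u \<in> fst G"
  then show "2 * card (rooted_subgraphs u G) = card (fst G) * (card (fst G) + 1) + 2"
    unfolding n unfolding G by (rule card_rooted_subgraphs_whole)
qed

text \<open>A maximal path in a 2-regular graph closes up: the second neighbour of its last vertex lies
  on the path, and every interior vertex is already saturated.\<close>

lemma is_cycle_if_two_regular:
  assumes sg: "simple_graph (V, E)" and conn: "connected_graph (V, E)"
    and deg: "\<And>v. v \<in> V \<Longrightarrow> card {e \<in> E. v \<in> e} = 2"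
  shows "is_cycle (V, E)"
proof -
  have E_sub: "e \<subseteq> V \<and> card e = 2" if "e \<in> E" for e
    using sg that by (auto simp: simple_graph_def)
  have finE: "finite E"
    using sg E_sub by (auto simp: simple_graph_def intro: finite_subset[of E "Pow V"])
  have irrefl: "a \<noteq> b" if "{a, b} \<in> E" for a b
    using E_sub[OF that] by auto
  have third: "e = e1 \<or> e = e2"
    if "v \<in> V" "e1 \<in> E" "e2 \<in> E" "e \<in> E" "v \<in> e1" "v \<in> e2" "v \<in> e" "e1 \<noteq> e2" for v e e1 e2
  proof (rule ccontr)
    assume "\<not> (e = e1 \<or> e = e2)"
    then have "card {e, e1, e2} = 3" using \<open>e1 \<noteq> e2\<close> by auto
    moreover have "card {e, e1, e2} \<le> card {e \<in> E. v \<in> e}"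
      by (rule card_mono) (use that finE in auto)
    ultimately show False using deg \<open>v \<in> V\<close> by simp
  qed
  have other: "\<exists>w. {v, w} \<in> E \<and> w \<noteq> a" if "v \<in> V" for v a
  proof -
    obtain e where e: "e \<in> E" "v \<in> e" "e \<noteq> {v, a}"
    proof (rule ccontr)
      assume "\<not> thesis"
      then have "{e \<in> E. v \<in> e} \<subseteq> {{v, a}}" using that by auto
      then have "card {e \<in> E. v \<in> e} \<le> card {{v, a}}" by (intro card_mono) auto
      then show False using deg[OF \<open>v \<in> V\<close>] by simp
    qed
    obtain w where "e = {v, w}"
      using E_sub[OF e(1)] e(2) by (auto simp: card_2_iff doubleton_eq_iff)
    then show ?thesis using e by auto
  qed
  define P where "P k p \<longleftrightarrow> inj_on p {..<k} \<and> p ` {..<k} \<subseteq> V \<and>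
    (\<forall>i. Suc i < k \<longrightarrow> {p i, p (Suc i)} \<in> E)" for k :: nat and p
  have bound: "k \<le> card V" if "P k p" for k p
  proof -
    have "card (p ` {..<k}) \<le> card V"
      using that sg by (intro card_mono) (auto simp: P_def simple_graph_def)
    then show ?thesis using that by (simp add: P_def card_image)
  qed
  obtain v0 where v0: "v0 \<in> V" using conn by (auto simp: connected_graph_def)
  then have "P 1 (\<lambda>_. v0)" by (auto simp: P_def inj_on_def)
  \<comment> \<open>Paths have at most \<open>card V\<close> vertices, so a longest one
    exists.\<close>
  define k where "k = (GREATEST k. \<exists>p. P k p)"
  have "\<exists>p. P k p"
    unfolding k_def by (rule GreatestI_nat[where k = 1 and b = "card V"])
      (use \<open>P 1 _\<close> bound in auto)
  then obtain p where p: "P k p" by auto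
  have maximal: "j \<le> k" if "P j q" for j q
    unfolding k_def by (rule Greatest_le_nat[where b = "card V"]) (use that bound in auto)
  have "k \<ge> 1" using maximal[OF \<open>P 1 _\<close>] .
  define z where "z = p (k - 1)"
  have inj: "inj_on p {..<k}" and pV: "\<And>i. i < k \<Longrightarrow> p i \<in> V"
    and pE: "\<And>i. Suc i < k \<Longrightarrow> {p i, p (Suc i)} \<in> E"
    using p by (auto simp: P_def)
  have p_inj: "p i = p j \<longleftrightarrow> i = j" if "i < k" "j < k" for i j
    using inj that by (auto simp: inj_on_def)
  have zV: "z \<in> V" unfolding z_def using \<open>k \<ge> 1\<close> by (intro pV) simp
  have on_path: "\<exists>j<k. w = p j" if "{z, w} \<in> E" for w
  proof (rule ccontr)
    assume *: "\<not> (\<exists>j<k. w = p j)"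
    have "w \<in> V" using E_sub[OF that] by auto
    have "P (Suc k) (p(k := w))"
      unfolding P_def
    proof (intro conjI allI impI)
      show "inj_on (p(k := w)) {..<Suc k}"
        using inj * by (auto simp: inj_on_def less_Suc_eq)
      show "(p(k := w)) ` {..<Suc k} \<subseteq> V"
        using pV \<open>w \<in> V\<close> by (auto simp: less_Suc_eq)
      fix i assume "Suc i < Suc k"
      then show "{(p(k := w)) i, (p(k := w)) (Suc i)} \<in> E"
        using pE that by (cases "Suc i = k") (auto simp: z_def)
    qed
    then show False using maximal by fastforce
  qed
  \<comment> \<open>A neighbour of the last vertex other than its predecessor on the path. For
    \<open>k = 1\<close> truncated subtraction turns \<open>k - 2\<close> into 0; then no
    \<open>j < k\<close> remains, so the conclusion \<open>j + 2 < k\<close> still holds.\<close>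
  obtain w where w: "{z, w} \<in> E" "w \<noteq> p (k - 2)" using other[OF zV] by blast
  obtain j where j: "j < k" "w = p j" using on_path w by blast
  have "j \<noteq> k - 1" using irrefl[OF w(1)] j by (auto simp: z_def)
  moreover have "j \<noteq> k - 2" using w j by auto
  ultimately have jk: "j + 2 < k" using j by auto
  have "j = 0"
  proof (rule ccontr)
    assume "j \<noteq> 0"
    then obtain i where i: "j = Suc i" by (cases j) auto
    have "{z, w} = {p i, p j} \<or> {z, w} = {p j, p (Suc j)}"
      by (rule third[of "p j"])
        (use i jk j pV pE[of i] pE[of j] w p_inj[of i "Suc j"] p_inj[of i j]
          in \<open>auto simp: doubleton_eq_iff\<close>)
    then show False
      using i jk j p_inj[of "k - 1" i] p_inj[of "k - 1" j] p_inj[of "k - 1" "Suc j"]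
      by (auto simp: z_def doubleton_eq_iff)
  qed
  then have k3: "k \<ge> 3" and close: "{z, p 0} \<in> E" using jk w j by auto
  define q where "q i = p (i mod k)" for i
  have mod_less: "i mod k < k" for i using k3 by simp
  interpret cyclic_enum k q
    using k3 p_inj mod_less by unfold_locales (auto simp: q_def)
  have edgeE: "edge i \<in> E" for i
  proof (cases "Suc (i mod k) = k")
    case True
    then have "Suc i mod k = 0" by (simp add: mod_Suc)
    moreover have "i mod k = k - 1" using True by simp
    ultimately show ?thesis using close by (simp add: edge_def q_def z_def insert_commute)
  next
    case False
    then have *: "Suc (i mod k) < k" using mod_less[of i] by simp
    then have "Suc i mod k = Suc (i mod k)" by (simp add: mod_Suc)
    then show ?thesis using pE[OF *] by (simp add: edge_def q_def)
  qed
  have qV: "q i \<in> V" for i using pV mod_less by (simp add: q_def)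
  have incident: "e = edge i \<or> e = edge (Suc i)" if "e \<in> E" "q (Suc i) \<in> e" for e i
  proof (rule third[of "q (Suc i)"])
    have "q i \<noteq> q (i + 1)" using p_eq_add_iff[of i 1] k3 by simp
    then show "edge i \<noteq> edge (Suc i)" by (simp add: edge_eq_iff)
  qed (use that edgeE qV in \<open>auto simp: edge_def\<close>)
  have range_Suc: "\<exists>i. x = q (Suc i)" if x: "x \<in> range q" for x
  proof -
    obtain i where "x = q i" using x by auto
    then have "x = q (Suc (i + (k - 1)))" using p_add_period[of i] k3 by simp
    then show ?thesis by blast
  qed
  \<comment> \<open>Each vertex of the closed path has its two cycle edges and no others, so no edge
    leaves it and connectedness makes it everything.\<close>
  have "V \<subseteq> range q"
  proof (rule connected_graph_closed_superset[OF conn qV[of 0]])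
    fix a b assume "a \<in> range q" and ab: "{a, b} \<in> E"
    then obtain i where "a = q (Suc i)" using range_Suc by blast
    then have "{a, b} = edge i \<or> {a, b} = edge (Suc i)" using incident ab by auto
    then show "b \<in> range q" by (auto simp: edge_def doubleton_eq_iff)
  qed auto
  then have V: "V = range q" using qV by auto
  have "E \<subseteq> range edge"
  proof
    fix e assume e: "e \<in> E"
    then obtain x where "x \<in> e" "x \<in> V" using E_sub[OF e] by (auto simp: card_2_iff)
    then obtain i where "x = q (Suc i)" using range_Suc[of x] V by auto
    then have "q (Suc i) \<in> e" using \<open>x \<in> e\<close> by simp
    then show "e \<in> range edge" using incident[OF e] by blast
  qed
  then have "(V, E) = whole" using V edgeE by (auto simp: whole_def)
  then show ?thesis unfolding is_cycle_def using cyclic_enum_axioms by blast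
qed

section \<open>Unicyclic graphs\<close>

lemma unicyclic_insert_pendant:
  assumes "unicyclic (V, E)" "u \<in> V" "v \<notin> V"
  shows "unicyclic (insert v V, insert {u, v} E)"
proof -
  have "{u, v} \<notin> E" "finite E" "finite V"
    using assms finite_subset[of E "Pow V"] by (auto simp: unicyclic_def simple_graph_def)
  then show ?thesis
    using assms by (auto simp: unicyclic_def simple_graph_insert_pendant connected_graph_insert_pendant)
qed

text \<open>As many edges as vertices must fit among the \<open>card V choose 2\<close>
  pairs.\<close>

lemma unicyclic_card_ge_3:
  assumes "unicyclic (V, E)"
  shows "card V \<ge> 3"
proof -
  have fin: "finite V" "V \<noteq> {}" "card E = card V" "E \<subseteq> {e. e \<subseteq> V \<and> card e = 2}"
    using assms by (auto simp: unicyclic_def simple_graph_def connected_graph_def)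
  have "card E \<le> card {e. e \<subseteq> V \<and> card e = 2}"
    using fin by (intro card_mono) auto
  also have "\<dots> = card V choose 2" using fin by (simp add: n_subsets)
  finally have "card V \<le> card V * (card V - 1) div 2" using fin by (simp add: choose_two)
  moreover have "card V > 0" using fin by (simp add: card_gt_0_iff)
  ultimately have "card V * 2 \<le> card V * (card V - 1)" by linarith
  then show ?thesis using \<open>card V > 0\<close> by auto
qed

text \<open>A leaf takes exactly one edge with it, so the two cardinalities stay equal. The result
  is phrased with \<open>insert\<close> to match the recursion for pendant vertices.\<close>

lemma unicyclic_delete_pendant:
  assumes uni: "unicyclic (V, E)" and v: "v \<in> V" and deg: "card {e \<in> E. v \<in> e} = 1"
  obtains u V' E' where "V = insert v V'" "E = insert {u, v} E'" "u \<in> V'" "v \<notin> V'"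
    "unicyclic (V', E')"
proof -
  have sg: "simple_graph (V, E)" and conn: "connected_graph (V, E)" and card: "card V = card E"
    using uni by (auto simp: unicyclic_def)
  have fin: "finite V" "finite E"
    using sg finite_subset[of E "Pow V"] by (auto simp: simple_graph_def)
  obtain e where e: "{e \<in> E. v \<in> e} = {e}" using deg by (auto simp: card_1_singleton_iff)
  then have eE: "e \<in> E" "v \<in> e" by auto
  then have "card e = 2" "e \<subseteq> V" using sg by (auto simp: simple_graph_def)
  then obtain u where u: "e = {u, v}" "u \<noteq> v" "u \<in> V"
    using \<open>v \<in> e\<close> by (auto simp: card_2_iff doubleton_eq_iff)
  have pend: "f = {u, v}" if "f \<in> E" "v \<in> f" for f using e that u by auto
  have "connected_graph (V - {v}, E - {{u, v}})"
    using conn u pend by (intro connected_graph_delete_pendant) auto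
  moreover have "simple_graph (V - {v}, E - {{u, v}})"
    using sg pend by (auto simp: simple_graph_def)
  ultimately have "unicyclic (V - {v}, E - {{u, v}})"
    using card fin v eE u by (simp add: unicyclic_def)
  then show ?thesis using that[of "V - {v}" u "E - {{u, v}}"] u v eE by auto
qed

text \<open>The handshake identity, by exchanging the order of summation over incidences.\<close>

lemma sum_degrees:
  assumes "simple_graph (V, E)"
  shows "(\<Sum>v\<in>V. card {e \<in> E. v \<in> e}) = 2 * card E"
proof -
  have fin: "finite V" "finite E" and e: "\<And>e. e \<in> E \<Longrightarrow> e \<subseteq> V \<and> card e = 2"
    using assms finite_subset[of E "Pow V"] by (auto simp: simple_graph_def)
  have "(\<Sum>v\<in>V. card {e \<in> E. v \<in> e}) = (\<Sum>e\<in>E. card {v \<in> V. v \<in> e})"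
    using sum.swap_restrict[OF fin, of "\<lambda>_ _. 1::nat" "\<lambda>v e. v \<in> e"] by simp
  also have "\<dots> = (\<Sum>e\<in>E. 2)"
  proof (rule sum.cong)
    fix f assume "f \<in> E"
    then have "{v \<in> V. v \<in> f} = f" using e by auto
    then show "card {v \<in> V. v \<in> f} = 2" using e \<open>f \<in> E\<close> by simp
  qed simp
  finally show ?thesis by simp
qed

text \<open>Connectedness rules out degree 0 and the assumption rules out degree 1, while the
  degrees sum to \<open>2 * card V\<close>; hence every degree is exactly 2.\<close>

lemma unicyclic_leafless_is_cycle:
  assumes uni: "unicyclic (V, E)" and deg: "\<And>v. v \<in> V \<Longrightarrow> card {e \<in> E. v \<in> e} \<noteq> 1"
  shows "is_cycle (V, E)"
proof (rule is_cycle_if_two_regular)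
  show sg: "simple_graph (V, E)" and conn: "connected_graph (V, E)"
    using uni by (auto simp: unicyclic_def)
  have fin: "finite V" "finite E"
    using sg finite_subset[of E "Pow V"] by (auto simp: simple_graph_def)
  have ge: "card {e \<in> E. v \<in> e} \<ge> 2" if v: "v \<in> V" for v
  proof -
    have "{e \<in> E. v \<in> e} \<noteq> {}"
    proof
      assume "{e \<in> E. v \<in> e} = {}"
      then have "V \<subseteq> {v}"
        by (intro connected_graph_closed_superset[OF conn v]) auto
      then have "card V \<le> card {v}" by (intro card_mono) auto
      then show False using unicyclic_card_ge_3[OF uni] by simp
    qed
    then have "card {e \<in> E. v \<in> e} \<noteq> 0" using fin by simp
    then show ?thesis using deg[OF v] by linarith
  qed
  fix v assume v: "v \<in> V"
  show "card {e \<in> E. v \<in> e} = 2"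
  proof (rule ccontr)
    assume "card {e \<in> E. v \<in> e} \<noteq> 2"
    then have "(\<Sum>v\<in>V. 2) < (\<Sum>v\<in>V. card {e \<in> E. v \<in> e})"
      using ge v fin by (intro sum_strict_mono_ex1) (auto intro!: bexI[of _ v] simp: less_le)
    then show False using sum_degrees[OF sg] uni by (simp add: unicyclic_def)
  qed
qed

text \<open>Strong induction on the number of vertices: strip a leaf if there is one, and otherwise
  the graph is a cycle.\<close>

lemma unicyclic_induct [consumes 1, case_names cycle pendant]:
  assumes "unicyclic G"
    and cyc: "\<And>G. is_cycle G \<Longrightarrow> P G"
    and pend: "\<And>V E u v. unicyclic (V, E) \<Longrightarrow> P (V, E) \<Longrightarrow> u \<in> V \<Longrightarrow> v \<notin> V \<Longrightarrow>
      P (insert v V, insert {u, v} E)"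
  shows "P G"
  using assms(1)
proof (induction "card (fst G)" arbitrary: G rule: less_induct)
  case less
  obtain V E where G: "G = (V, E)" by (cases G)
  show ?case
  proof (cases "\<exists>v\<in>V. card {e \<in> E. v \<in> e} = 1")
    case False
    then have "is_cycle G"
      unfolding G using less.prems G by (intro unicyclic_leafless_is_cycle) auto
    then show ?thesis by (rule cyc)
  next
    case True
    then obtain v where v: "v \<in> V" "card {e \<in> E. v \<in> e} = 1" by auto
    have "unicyclic (V, E)" using less.prems G by simp
    from unicyclic_delete_pendant[OF this v]
    obtain u V' E' where *: "V = insert v V'" "E = insert {u, v} E'" "u \<in> V'" "v \<notin> V'"
      "unicyclic (V', E')" by metis
    have "finite V'" using *(5) by (simp add: unicyclic_def simple_graph_def)
    then have "P (V', E')" using less.hyps[of "(V', E')"] * G by simp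
    then show ?thesis unfolding G *(1,2) using * by (intro pend) auto
  qed
qed

section \<open>Lower bounds for rooted counts and the core index\<close>

text \<open>For a cycle, \<open>n * (n + 1) / 2 + 1\<close> is at least \<open>n + 4\<close>, with
  equality for the triangle, and every attached leaf gains at least one. The root must be arbitrary
  in the induction because the count at a new leaf comes from the count at its neighbour.\<close>

lemma card_rooted_subgraphs_ge:
  assumes "unicyclic G" "w \<in> fst G"
  shows "card (fst G) + 4 \<le> card (rooted_subgraphs w G)"
  using assms
proof (induction arbitrary: w rule: unicyclic_induct)
  case (cycle G)
  let ?n = "card (fst G)"
  have "?n \<ge> 3" using unicyclic_card_ge_3 unicyclic_cycle[OF cycle(1)] by (cases G) auto
  then have "?n * (?n + 1) \<ge> 3 * (?n + 1)" by (intro mult_right_mono) auto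
  then have "3 * (?n + 1) + 2 \<le> 2 * card (rooted_subgraphs w G)"
    using card_rooted_subgraphs_cycle[OF cycle] by simp
  then show ?case using \<open>?n \<ge> 3\<close> by simp
next
  case (pendant V E u v)
  have sg: "simple_graph (V, E)" and conn: "connected_graph (V, E)" and fin: "finite V"
    using pendant by (auto simp: unicyclic_def simple_graph_def)
  show ?case
  proof (cases "w = v")
    case True
    then show ?thesis
      using card_rooted_subgraphs_pendant[OF sg pendant.hyps(2,3)] pendant fin by fastforce
  next
    case False
    then have w: "w \<in> V" using pendant by simp
    show ?thesis
      using card_rooted_subgraphs_insert_pendant[OF sg conn pendant.hyps(2,3) w] pendant w fin
      by fastforce
  qed
qed

text \<open>A leaf attached to a noncycle on \<open>n\<close> vertices adds at least
  \<open>1 + (n + 4)\<close>, and the doubled bound grows by exactly \<open>2 * n + 10\<close>.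
  Cycles are set apart because those of length 4 and 5 violate the bound.\<close>

lemma core_index_unicyclic_ge:
  assumes "unicyclic G"
  shows "is_cycle G \<or> (card (fst G))\<^sup>2 + 9 * card (fst G) \<le> 2 * core_index G + 16"
  using assms
proof (induction rule: unicyclic_induct)
  case (pendant V E u v)
  let ?n = "card V"
  have sg: "simple_graph (V, E)" and fin: "finite V"
    using pendant by (auto simp: unicyclic_def simple_graph_def)
  have n: "?n \<ge> 3" using pendant.hyps(1) by (rule unicyclic_card_ge_3)
  have rec: "core_index (insert v V, insert {u, v} E) =
      core_index (V, E) + 1 + card (rooted_subgraphs u (V, E))"
    using sg pendant.hyps(2,3) by (rule core_index_insert_pendant)
  have "(?n + 1)\<^sup>2 + 9 * (?n + 1) \<le> 2 * core_index (insert v V, insert {u, v} E) + 16"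
  proof (cases "is_cycle (V, E)")
    case True
    \<comment> \<open>For a cycle with one leaf, the two sides differ by
      \<open>2 * (n - 2) * (n - 3)\<close> with \<open>n\<close> the cycle length; substituting
      \<open>3 + k\<close> makes this visibly nonnegative.\<close>
    obtain k where k: "?n = 3 + k" using le_Suc_ex[OF n] by blast
    show ?thesis
      using core_index_cycle[OF True] card_rooted_subgraphs_cycle[OF True, of u] pendant.hyps(2)
      unfolding rec by (simp add: k power2_eq_square algebra_simps)
  next
    case False
    then show ?thesis
      using pendant.IH card_rooted_subgraphs_ge[OF pendant.hyps(1), of u] pendant.hyps(2)
      unfolding rec by (simp add: power2_eq_square)
  qed
  then show ?case using fin pendant.hyps(3) by simp
qed simp

section \<open>The two extremal graphs\<close>

lemma is_cycle_cycle_graph: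
  assumes "n \<ge> 3"
  shows "is_cycle (cycle_graph n)"
proof -
  interpret cyclic_enum n "\<lambda>i. i mod n" by unfold_locales (use assms in auto)
  have "edge i = {i, (i + 1) mod n}" if "i < n" for i
    using that by (simp add: edge_def)
  then have "edge ` {..<n} = {{i, (i + 1) mod n} | i. i < n}"
    by (auto simp: image_iff)
  moreover have "(\<lambda>i. i mod n) ` {..<n} = {0..<n}"
    by (auto simp: image_iff)
  ultimately have "cycle_graph n = whole"
    by (simp add: cycle_graph_def whole_def range_p range_edge)
  then show ?thesis unfolding is_cycle_def using cyclic_enum_axioms by blast
qed

lemma lollipop_graph_3: "lollipop_graph 3 = cycle_graph 3"
proof -
  have "{..<3::nat} = {0, 1, 2}" by auto
  moreover have "{{i, (i + 1) mod 3} | i. i < 3} = (\<lambda>i. {i, (i + 1) mod 3}) ` {..<3::nat}" by auto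
  ultimately have "{{i, (i + 1) mod 3} | i. i < (3::nat)} = {{0, 1}, {0, 2}, {1, 2}}"
    by (simp add: insert_commute numeral_2_eq_2)
  moreover have "{{i, i + 1} | i. 2 \<le> i \<and> i + 1 < (3::nat)} = {}" by auto
  ultimately show ?thesis
    unfolding lollipop_graph_def cycle_graph_def by (simp only: Un_empty_right)
qed

text \<open>The path grows at its free end \<open>n - 1\<close>; for \<open>n = 3\<close> this is
  the triangle vertex 2, where the path begins.\<close>

lemma lollipop_graph_Suc:
  assumes "n \<ge> 3"
  shows "lollipop_graph (Suc n) =
    (insert n (fst (lollipop_graph n)), insert {n - 1, n} (snd (lollipop_graph n)))"
proof -
  have "{{i, i + 1} | i. 2 \<le> i \<and> i + 1 < Suc n} =
      insert {n - 1, n} {{i, i + 1} | i. 2 \<le> i \<and> i + 1 < n}" (is "?L = ?R")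
  proof (intro equalityI subsetI)
    fix e assume "e \<in> ?L"
    then obtain i where i: "e = {i, i + 1}" "2 \<le> i" "i + 1 < Suc n" by auto
    then show "e \<in> ?R" by (cases "i + 1 = n") auto
  next
    fix e assume "e \<in> ?R"
    then consider "e = {n - 1, n - 1 + 1}" | i where "e = {i, i + 1}" "2 \<le> i" "i + 1 < n"
      using assms by auto
    then show "e \<in> ?L"
    proof cases
      case 1
      moreover have "2 \<le> n - 1" "n - 1 + 1 < Suc n" using assms by auto
      ultimately show ?thesis by blast
    next
      case 2
      then show ?thesis using less_SucI by blast
    qed
  qed
  then show ?thesis
    unfolding lollipop_graph_def fst_conv snd_conv atLeast0_lessThan_Suc
    by (simp only: Un_insert_right)
qed

text \<open>The claims are proved together: the core index recursion consumes the rooted count at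
  the end \<open>n - 1\<close>, and the new end has that count plus one. Starting from the triangle,
  both lower bounds are thus met with equality at every step.\<close>

lemma lollipop_graph_properties:
  assumes "n \<ge> 3"
  shows "unicyclic (lollipop_graph n) \<and>
    card (rooted_subgraphs (n - 1) (lollipop_graph n)) = n + 4 \<and>
    2 * core_index (lollipop_graph n) + 16 = n\<^sup>2 + 9 * n"
  using assms
proof (induction n rule: dec_induct)
  case base
  have "is_cycle (cycle_graph 3)" by (rule is_cycle_cycle_graph) simp
  then show ?case
    unfolding lollipop_graph_3
    using unicyclic_cycle core_index_cycle[of "cycle_graph 3"]
      card_rooted_subgraphs_cycle[of "cycle_graph 3" 2]
    by (simp add: cycle_graph_def)
next
  case (step n)
  obtain V E where G: "lollipop_graph n = (V, E)" by (cases "lollipop_graph n")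
  have V: "V = {0..<n}" using G by (simp add: lollipop_graph_def)
  have mem: "n - 1 \<in> V" "n \<notin> V" using V step by auto
  have uni: "unicyclic (V, E)" using step G by simp
  then have sg: "simple_graph (V, E)" by (simp add: unicyclic_def)
  have Suc: "lollipop_graph (Suc n) = (insert n V, insert {n - 1, n} E)"
    using lollipop_graph_Suc[of n] step G by simp
  show ?case
    using step.IH unicyclic_insert_pendant[OF uni mem]
      core_index_insert_pendant[OF sg mem] card_rooted_subgraphs_pendant[OF sg mem]
    unfolding Suc G by (simp add: power2_eq_square)
qed

theorem theorem4p11:
  fixes n :: nat
  assumes "n \<ge> 4"
  shows
    "(n \<ge> 7 \<longrightarrow>
        lollipop_graph n \<in> unicyclic_graphs n \<and>
        (\<forall>H \<in> (unicyclic_graphs n :: 'a ugraph set). core_index (lollipop_graph n) \<le> core_index H)) \<and>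
     (n \<le> 5 \<longrightarrow>
        cycle_graph n \<in> unicyclic_graphs n \<and>
        (\<forall>H \<in> (unicyclic_graphs n :: 'a ugraph set). core_index (cycle_graph n) \<le> core_index H)) \<and>
     (n = 6 \<longrightarrow>
        cycle_graph n \<in> unicyclic_graphs n \<and>
        lollipop_graph n \<in> unicyclic_graphs n \<and>
        (\<forall>H \<in> (unicyclic_graphs n :: 'a ugraph set).
           core_index (cycle_graph n) \<le> core_index H \<and>
           core_index (lollipop_graph n) \<le> core_index H))"
proof -
  have n3: "n \<ge> 3" using assms by simp
  note cyc = is_cycle_cycle_graph[OF n3]
  have C: "cycle_graph n \<in> unicyclic_graphs n"
    using unicyclic_cycle[OF cyc] by (simp add: unicyclic_graphs_def cycle_graph_def)
  have FC: "core_index (cycle_graph n) = n\<^sup>2 + 1"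
    using core_index_cycle[OF cyc] by (simp add: cycle_graph_def)
  have L: "lollipop_graph n \<in> unicyclic_graphs n"
    and FL: "2 * core_index (lollipop_graph n) + 16 = n\<^sup>2 + 9 * n"
    using lollipop_graph_properties[OF n3] by (simp_all add: unicyclic_graphs_def lollipop_graph_def)
  have lower: "core_index H = n\<^sup>2 + 1 \<or> n\<^sup>2 + 9 * n \<le> 2 * core_index H + 16"
    if "H \<in> unicyclic_graphs n" for H :: "'a ugraph"
    using that core_index_unicyclic_ge[of H] core_index_cycle[of H]
    by (auto simp: unicyclic_graphs_def)
  have large: "n\<^sup>2 + 9 * n \<le> 2 * (n\<^sup>2 + 1) + 16" if n6: "n \<ge> 6"
  proof -
    obtain k where "n = 6 + k" using le_Suc_ex[OF n6] by blast
    then show ?thesis by (simp add: power2_eq_square algebra_simps)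
  qed
  have small: "2 * (n\<^sup>2 + 1) + 16 \<le> n\<^sup>2 + 9 * n" if "n \<le> 6"
  proof -
    have "n = 4 \<or> n = 5 \<or> n = 6" using that assms by auto
    then show ?thesis by auto
  qed
  have minL: "core_index (lollipop_graph n) \<le> core_index H"
    if "n \<ge> 6" "H \<in> unicyclic_graphs n" for H :: "'a ugraph"
    using lower[OF that(2)] FL large[OF that(1)] by auto
  have minC: "core_index (cycle_graph n) \<le> core_index H"
    if "n \<le> 6" "H \<in> unicyclic_graphs n" for H :: "'a ugraph"
    using lower[OF that(2)] FC small[OF that(1)] by auto
  show ?thesis using C L minL minC by auto
qed

end
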